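(* Let $k\ge 0$ and fix $r\in\mathbb{N}$. If $\psi:\Lambda_1\to\Lambda_2$ is a $k$-graph morphism between $k$-graphs, then there is a homomorphism $\psi_*:H_r(\Lambda_1)\to H_r(\Lambda_2)$ determined on generators by $\lambda\mapsto\psi(\lambda)$ for $\lambda\in Q_r(\Lambda_1)$; that is, $\psi_*\big(\big[\sum_\lambda a_\lambda\lambda\big]\big)=\big[\sum_\lambda a_\lambda\psi(\lambda)\big]$ for every cycle $\sum_\lambda a_\lambda\lambda\in\ker\partial_r\subseteq \mathbb{Z}Q_r(\Lambda_1)$. Moreover, the assignments $\Lambda\mapsto H_r(\Lambda)$ and $\psi\mapsto\psi_*$ comprise a covariant functor from the category of $k$-graphs with $k$-graph morphisms to the category of abelian groups with homomorphisms.
   Context: Conventions: $0\in\mathbb{N}$ and $\mathbb{N}^0=\{0\}$. A $k$-graph ($k\ge0$) is a nonempty countable small category $\Lambda$ with a functor $d:\Lambda\to\mathbb{N}^k$ (the degree) satisfying the factorisation property: whenever $d(\lambda)=m+n$ there are unique $\mu,\nu\in\Lambda$ with $d(\mu)=m$, $d(\nu)=n$, $\lambda=\mu\nu$. Objects are identified with identity morphisms; $\Lambda^n=d^{-1}(n)$, so $\Lambda^0$ is the set of vertices; $r,s:\Lambda\to\Lambda^0$ are the codomain and domain maps, and $\mu\nu$ is defined when $s(\mu)=r(\nu)$. $e_1,\dots,e_k$ are the standard generators of $\mathbb{N}^k$, $\mathbf{1}_k=\sum_i e_i$, $\le$ on $\mathbb{N}^k$ is coordinatewise, $|n|=\sum_i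 n_i$. A $k$-graph morphism is a degree-preserving functor. Homology: $Q_r(\Lambda)=\{\lambda\in\Lambda: d(\lambda)\le\mathbf{1}_k,\ |d(\lambda)|=r\}$. For $\lambda\in Q_r(\Lambda)$ with $d(\lambda)=e_{i_1}+\dots+e_{i_r}$, $i_1<\dots<i_r$, and $1\le j\le r$, the faces $F_j^0(\lambda),F_j^1(\lambda)\in Q_{r-1}(\Lambda)$ are the unique elements for which there are $\alpha,\beta\in\Lambda^{e_{i_j}}$ with $F_j^0(\lambda)\beta=\lambda=\alpha F_j^1(\lambda)$. $C_r(\Lambda)=\mathbb{Z}Q_r(\Lambda)$ is the free abelian group on $Q_r(\Lambda)$; for $r\ge1$, $\partial_r:C_r(\Lambda)\to C_{r-1}(\Lambda)$ is the homomorphism with $\partial_r(\lambda)=\sum_{\ell=0}^1\sum_{i=1}^r(-1)^{i+\ell}F_i^\ell(\lambda)$, and $\partial_0=0$. This is a chain complex and $H_r(\Lambda)=\ker\partial_r/\operatorname{Im}\partial_{r+1}$. *)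

theory Defs
  imports
    "HOL-Algebra.Free_Abelian_Groups"
    "HOL-Library.Countable_Set"
begin

section \<open>\<open>k\<close>-graphs\<close>

text \<open>
  Categories are presented by their morphisms alone: the objects are the identity morphisms, that
  is, the values of \<open>src\<close> and \<open>rng\<close>.  The value \<open>mor_comp \<Lambda> \<mu> \<nu>\<close> stands for \<open>\<mu>\<nu>\<close> and is meaningful
  only for arrows with \<open>src \<Lambda> \<mu> = rng \<Lambda> \<nu>\<close>.  An element \<open>n\<close> of \<open>\<nat>\<^sup>k\<close> is a function on the
  natural numbers that vanishes outside \<open>{..<k}\<close>, so that the coordinates are numbered from 0
  and \<open>k = 0\<close> gives the one-point monoid.
\<close>

record 'a kgraph_data =
  arrows :: "'a set"
  src :: "'a \<Rightarrow> 'a"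
  rng :: "'a \<Rightarrow> 'a"
  mor_comp :: "'a \<Rightarrow> 'a \<Rightarrow> 'a"
  deg :: "'a \<Rightarrow> nat \<Rightarrow> nat"

definition Nk :: "nat \<Rightarrow> (nat \<Rightarrow> nat) set" where
  "Nk k = {n. \<forall>i. k \<le> i \<longrightarrow> n i = 0}"

definition Nk_unit :: "nat \<Rightarrow> nat \<Rightarrow> nat" where
  "Nk_unit i = (\<lambda>j. if j = i then 1 else 0)"

definition Nk_ones :: "nat \<Rightarrow> nat \<Rightarrow> nat" where
  "Nk_ones k = (\<lambda>j. \<Sum>i<k. Nk_unit i j)"

definition Nk_length :: "nat \<Rightarrow> (nat \<Rightarrow> nat) \<Rightarrow> nat" where
  "Nk_length k n = (\<Sum>i<k. n i)"

locale small_category =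
  fixes \<Lambda> :: "'a kgraph_data"
  assumes src_closed: "x \<in> arrows \<Lambda> \<Longrightarrow> src \<Lambda> x \<in> arrows \<Lambda>"
    and rng_closed: "x \<in> arrows \<Lambda> \<Longrightarrow> rng \<Lambda> x \<in> arrows \<Lambda>"
    and src_src: "x \<in> arrows \<Lambda> \<Longrightarrow> src \<Lambda> (src \<Lambda> x) = src \<Lambda> x"
    and rng_src: "x \<in> arrows \<Lambda> \<Longrightarrow> rng \<Lambda> (src \<Lambda> x) = src \<Lambda> x"
    and src_rng: "x \<in> arrows \<Lambda> \<Longrightarrow> src \<Lambda> (rng \<Lambda> x) = rng \<Lambda> x"
    and rng_rng: "x \<in> arrows \<Lambda> \<Longrightarrow> rng \<Lambda> (rng \<Lambda> x) = rng \<Lambda> x"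
    and comp_closed: "\<lbrakk>\<mu> \<in> arrows \<Lambda>; \<nu> \<in> arrows \<Lambda>; src \<Lambda> \<mu> = rng \<Lambda> \<nu>\<rbrakk> \<Longrightarrow> mor_comp \<Lambda> \<mu> \<nu> \<in> arrows \<Lambda>"
    and src_comp: "\<lbrakk>\<mu> \<in> arrows \<Lambda>; \<nu> \<in> arrows \<Lambda>; src \<Lambda> \<mu> = rng \<Lambda> \<nu>\<rbrakk> \<Longrightarrow> src \<Lambda> (mor_comp \<Lambda> \<mu> \<nu>) = src \<Lambda> \<nu>"
    and rng_comp: "\<lbrakk>\<mu> \<in> arrows \<Lambda>; \<nu> \<in> arrows \<Lambda>; src \<Lambda> \<mu> = rng \<Lambda> \<nu>\<rbrakk> \<Longrightarrow> rng \<Lambda> (mor_comp \<Lambda> \<mu> \<nu>) = rng \<Lambda> \<mu>"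
    and comp_assoc: "\<lbrakk>x \<in> arrows \<Lambda>; \<mu> \<in> arrows \<Lambda>; \<nu> \<in> arrows \<Lambda>; src \<Lambda> x = rng \<Lambda> \<mu>; src \<Lambda> \<mu> = rng \<Lambda> \<nu>\<rbrakk>
      \<Longrightarrow> mor_comp \<Lambda> (mor_comp \<Lambda> x \<mu>) \<nu> = mor_comp \<Lambda> x (mor_comp \<Lambda> \<mu> \<nu>)"
    and comp_rng: "x \<in> arrows \<Lambda> \<Longrightarrow> mor_comp \<Lambda> (rng \<Lambda> x) x = x"
    and comp_src: "x \<in> arrows \<Lambda> \<Longrightarrow> mor_comp \<Lambda> x (src \<Lambda> x) = x"

locale kgraph = small_category \<Lambda> for k :: nat and \<Lambda> :: "'a kgraph_data" +
  assumes arrows_nonempty: "arrows \<Lambda> \<noteq> {}"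
    and arrows_countable: "countable (arrows \<Lambda>)"
    and deg_Nk: "x \<in> arrows \<Lambda> \<Longrightarrow> deg \<Lambda> x \<in> Nk k"
    and deg_src: "x \<in> arrows \<Lambda> \<Longrightarrow> deg \<Lambda> (src \<Lambda> x) = (\<lambda>i. 0)"
    and deg_rng: "x \<in> arrows \<Lambda> \<Longrightarrow> deg \<Lambda> (rng \<Lambda> x) = (\<lambda>i. 0)"
    and deg_comp: "\<lbrakk>\<mu> \<in> arrows \<Lambda>; \<nu> \<in> arrows \<Lambda>; src \<Lambda> \<mu> = rng \<Lambda> \<nu>\<rbrakk>
      \<Longrightarrow> deg \<Lambda> (mor_comp \<Lambda> \<mu> \<nu>) = (\<lambda>i. deg \<Lambda> \<mu> i + deg \<Lambda> \<nu> i)"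
    and factorisation: "\<lbrakk>x \<in> arrows \<Lambda>; m \<in> Nk k; n \<in> Nk k; deg \<Lambda> x = (\<lambda>i. m i + n i)\<rbrakk>
      \<Longrightarrow> \<exists>!(\<mu>, \<nu>). \<mu> \<in> arrows \<Lambda> \<and> \<nu> \<in> arrows \<Lambda> \<and> src \<Lambda> \<mu> = rng \<Lambda> \<nu> \<and>
            deg \<Lambda> \<mu> = m \<and> deg \<Lambda> \<nu> = n \<and> x = mor_comp \<Lambda> \<mu> \<nu>"

locale kgraph_morphism = dom: kgraph k \<Lambda>1 + cod: kgraph k \<Lambda>2
  for k :: nat and \<Lambda>1 :: "'a kgraph_data" and \<Lambda>2 :: "'b kgraph_data" and \<psi> :: "'a \<Rightarrow> 'b" +
  assumes map_arrows: "x \<in> arrows \<Lambda>1 \<Longrightarrow> \<psi> x \<in> arrows \<Lambda>2"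
    and map_src: "x \<in> arrows \<Lambda>1 \<Longrightarrow> \<psi> (src \<Lambda>1 x) = src \<Lambda>2 (\<psi> x)"
    and map_rng: "x \<in> arrows \<Lambda>1 \<Longrightarrow> \<psi> (rng \<Lambda>1 x) = rng \<Lambda>2 (\<psi> x)"
    and map_comp: "\<lbrakk>\<mu> \<in> arrows \<Lambda>1; \<nu> \<in> arrows \<Lambda>1; src \<Lambda>1 \<mu> = rng \<Lambda>1 \<nu>\<rbrakk>
      \<Longrightarrow> \<psi> (mor_comp \<Lambda>1 \<mu> \<nu>) = mor_comp \<Lambda>2 (\<psi> \<mu>) (\<psi> \<nu>)"
    and map_deg: "x \<in> arrows \<Lambda>1 \<Longrightarrow> deg \<Lambda>2 (\<psi> x) = deg \<Lambda>1 x"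


section \<open>Homology\<close>

definition cubes :: "nat \<Rightarrow> nat \<Rightarrow> 'a kgraph_data \<Rightarrow> 'a set" where
  "cubes k r \<Lambda> = {x \<in> arrows \<Lambda>. deg \<Lambda> x \<le> Nk_ones k \<and> Nk_length k (deg \<Lambda> x) = r}"

text \<open>
  \<open>cube_dir k \<Lambda> x j\<close> is \<open>i\<^sub>j\<close>, where \<open>x\<close> has degree \<open>e\<^bsub>i\<^sub>1\<^esub> + \<dots> + e\<^bsub>i\<^sub>r\<^esub>\<close> with \<open>i\<^sub>1 < \<dots> < i\<^sub>r\<close>.
  Here \<open>j\<close> runs from 1 to \<open>r\<close>, whereas list positions start at 0.
\<close>

definition cube_dir :: "nat \<Rightarrow> 'a kgraph_data \<Rightarrow> 'a \<Rightarrow> nat \<Rightarrow> nat" where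
  "cube_dir k \<Lambda> x j = sorted_list_of_set {i. i < k \<and> deg \<Lambda> x i \<noteq> 0} ! (j - 1)"

definition face0 :: "nat \<Rightarrow> nat \<Rightarrow> 'a kgraph_data \<Rightarrow> nat \<Rightarrow> 'a \<Rightarrow> 'a" where
  "face0 k r \<Lambda> j x = (THE \<mu>. \<mu> \<in> cubes k (r - 1) \<Lambda> \<and>
     (\<exists>\<beta> \<in> arrows \<Lambda>. deg \<Lambda> \<beta> = Nk_unit (cube_dir k \<Lambda> x j) \<and> src \<Lambda> \<mu> = rng \<Lambda> \<beta> \<and> mor_comp \<Lambda> \<mu> \<beta> = x))"

definition face1 :: "nat \<Rightarrow> nat \<Rightarrow> 'a kgraph_data \<Rightarrow> nat \<Rightarrow> 'a \<Rightarrow> 'a" where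
  "face1 k r \<Lambda> j x = (THE \<mu>. \<mu> \<in> cubes k (r - 1) \<Lambda> \<and>
     (\<exists>\<alpha> \<in> arrows \<Lambda>. deg \<Lambda> \<alpha> = Nk_unit (cube_dir k \<Lambda> x j) \<and> src \<Lambda> \<alpha> = rng \<Lambda> \<mu> \<and> mor_comp \<Lambda> \<alpha> \<mu> = x))"

definition face :: "nat \<Rightarrow> nat \<Rightarrow> 'a kgraph_data \<Rightarrow> nat \<Rightarrow> nat \<Rightarrow> 'a \<Rightarrow> 'a" where
  "face k r \<Lambda> l = (if l = 0 then face0 k r \<Lambda> else face1 k r \<Lambda>)"

abbreviation chain_group :: "nat \<Rightarrow> nat \<Rightarrow> 'a kgraph_data \<Rightarrow> ('a \<Rightarrow>\<^sub>0 int) monoid" where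
  "chain_group k r \<Lambda> \<equiv> free_Abelian_group (cubes k r \<Lambda>)"

text \<open>
  For \<open>r = 0\<close> the inner sum is empty, so that \<open>bd k 0 \<Lambda>\<close> is zero and every 0-chain is a cycle;
  the truncated index \<open>r - 1\<close> in \<open>cycles\<close> is then harmless.
\<close>

definition bd :: "nat \<Rightarrow> nat \<Rightarrow> 'a kgraph_data \<Rightarrow> ('a \<Rightarrow>\<^sub>0 int) \<Rightarrow> ('a \<Rightarrow>\<^sub>0 int)" where
  "bd k r \<Lambda> = frag_extend (\<lambda>x. \<Sum>l=0..1. \<Sum>i=1..r. frag_cmul ((-1) ^ (i + l)) (frag_of (face k r \<Lambda> l i x)))"

definition cycles :: "nat \<Rightarrow> nat \<Rightarrow> 'a kgraph_data \<Rightarrow> ('a \<Rightarrow>\<^sub>0 int) set" where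
  "cycles k r \<Lambda> = kernel (chain_group k r \<Lambda>) (chain_group k (r - 1) \<Lambda>) (bd k r \<Lambda>)"

definition boundaries :: "nat \<Rightarrow> nat \<Rightarrow> 'a kgraph_data \<Rightarrow> ('a \<Rightarrow>\<^sub>0 int) set" where
  "boundaries k r \<Lambda> = bd k (Suc r) \<Lambda> ` carrier (chain_group k (Suc r) \<Lambda>)"

definition cycle_group :: "nat \<Rightarrow> nat \<Rightarrow> 'a kgraph_data \<Rightarrow> ('a \<Rightarrow>\<^sub>0 int) monoid" where
  "cycle_group k r \<Lambda> = (chain_group k r \<Lambda>)\<lparr>carrier := cycles k r \<Lambda>\<rparr>"

definition homology :: "nat \<Rightarrow> nat \<Rightarrow> 'a kgraph_data \<Rightarrow> ('a \<Rightarrow>\<^sub>0 int) set monoid" where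
  "homology k r \<Lambda> = cycle_group k r \<Lambda> Mod boundaries k r \<Lambda>"

definition homology_class :: "nat \<Rightarrow> nat \<Rightarrow> 'a kgraph_data \<Rightarrow> ('a \<Rightarrow>\<^sub>0 int) \<Rightarrow> ('a \<Rightarrow>\<^sub>0 int) set" where
  "homology_class k r \<Lambda> c = boundaries k r \<Lambda> #>\<^bsub>cycle_group k r \<Lambda>\<^esub> c"

definition pushforward :: "('a \<Rightarrow> 'b) \<Rightarrow> ('a \<Rightarrow>\<^sub>0 int) \<Rightarrow> ('b \<Rightarrow>\<^sub>0 int)" where
  "pushforward \<psi> = frag_extend (\<lambda>x. frag_of (\<psi> x))"

text \<open>Homomorphisms are determined only on the carrier; \<open>extensional\<close> fixes their values outside it.\<close>

definition homology_map ::
  "nat \<Rightarrow> nat \<Rightarrow> 'a kgraph_data \<Rightarrow> 'b kgraph_data \<Rightarrow> ('a \<Rightarrow> 'b) \<Rightarrow> ('a \<Rightarrow>\<^sub>0 int) set \<Rightarrow> ('b \<Rightarrow>\<^sub>0 int) set" where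
  "homology_map k r \<Lambda>1 \<Lambda>2 \<psi> =
     (THE f. f \<in> hom (homology k r \<Lambda>1) (homology k r \<Lambda>2) \<inter> extensional (carrier (homology k r \<Lambda>1)) \<and>
             (\<forall>c \<in> cycles k r \<Lambda>1.
                f (homology_class k r \<Lambda>1 c) = homology_class k r \<Lambda>2 (pushforward \<psi> c)))"


section \<open>Categories and functors\<close>

text \<open>
  A category is given by its family of hom-sets.  Composition \<open>cmp C x y z g f\<close> (with \<open>f\<close> from \<open>x\<close>
  to \<open>y\<close> and \<open>g\<close> from \<open>y\<close> to \<open>z\<close>) takes the objects as arguments, so that hom-sets of different
  pairs of objects need not be disjoint.
\<close>

record ('o, 'm) cat =
  objects :: "'o set"
  homset :: "'o \<Rightarrow> 'o \<Rightarrow> 'm set"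
  ident :: "'o \<Rightarrow> 'm"
  cmp :: "'o \<Rightarrow> 'o \<Rightarrow> 'o \<Rightarrow> 'm \<Rightarrow> 'm \<Rightarrow> 'm"

locale category =
  fixes C :: "('o, 'm) cat"
  assumes ident_hom: "x \<in> objects C \<Longrightarrow> ident C x \<in> homset C x x"
    and cmp_hom: "\<lbrakk>x \<in> objects C; y \<in> objects C; z \<in> objects C; f \<in> homset C x y; g \<in> homset C y z\<rbrakk>
      \<Longrightarrow> cmp C x y z g f \<in> homset C x z"
    and ident_left: "\<lbrakk>x \<in> objects C; y \<in> objects C; f \<in> homset C x y\<rbrakk>
      \<Longrightarrow> cmp C x y y (ident C y) f = f"
    and ident_right: "\<lbrakk>x \<in> objects C; y \<in> objects C; f \<in> homset C x y\<rbrakk>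
      \<Longrightarrow> cmp C x x y f (ident C x) = f"
    and cmp_assoc: "\<lbrakk>w \<in> objects C; x \<in> objects C; y \<in> objects C; z \<in> objects C;
        f \<in> homset C w x; g \<in> homset C x y; h \<in> homset C y z\<rbrakk>
      \<Longrightarrow> cmp C w x z (cmp C x y z h g) f = cmp C w y z h (cmp C w x y g f)"

locale covariant_functor = source: category C + target: category D
  for C :: "('o, 'm) cat" and D :: "('p, 'n) cat" and F :: "'o \<Rightarrow> 'p" and M :: "'o \<Rightarrow> 'o \<Rightarrow> 'm \<Rightarrow> 'n" +
  assumes map_object: "x \<in> objects C \<Longrightarrow> F x \<in> objects D"
    and map_hom: "\<lbrakk>x \<in> objects C; y \<in> objects C; f \<in> homset C x y\<rbrakk>
      \<Longrightarrow> M x y f \<in> homset D (F x) (F y)"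
    and map_ident: "x \<in> objects C \<Longrightarrow> M x x (ident C x) = ident D (F x)"
    and map_cmp: "\<lbrakk>x \<in> objects C; y \<in> objects C; z \<in> objects C; f \<in> homset C x y; g \<in> homset C y z\<rbrakk>
      \<Longrightarrow> M x z (cmp C x y z g f) = cmp D (F x) (F y) (F z) (M y z g) (M x y f)"

definition kgraph_cat :: "nat \<Rightarrow> ('a kgraph_data, 'a \<Rightarrow> 'a) cat" where
  "kgraph_cat k = \<lparr>
     objects = {\<Lambda>. kgraph k \<Lambda>},
     homset = (\<lambda>\<Lambda>1 \<Lambda>2. {\<psi>. kgraph_morphism k \<Lambda>1 \<Lambda>2 \<psi>} \<inter> extensional (arrows \<Lambda>1)),
     ident = (\<lambda>\<Lambda>. restrict id (arrows \<Lambda>)),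
     cmp = (\<lambda>\<Lambda>1 \<Lambda>2 \<Lambda>3 \<phi> \<psi>. compose (arrows \<Lambda>1) \<phi> \<psi>)\<rparr>"

definition abelian_group_cat :: "('g monoid, 'g \<Rightarrow> 'g) cat" where
  "abelian_group_cat = \<lparr>
     objects = {G. comm_group G},
     homset = (\<lambda>G H. hom G H \<inter> extensional (carrier G)),
     ident = (\<lambda>G. restrict id (carrier G)),
     cmp = (\<lambda>G H K g f. compose (carrier G) g f)\<rparr>"

end

theory Submission imports Defs begin

text \<open>
  A degree-preserving functor sends a factorisation of a cube to a factorisation of its image with
  the same degrees.  The faces of a cube are singled out by such factorisations, and the directions
  \<open>i\<^sub>1 < \<dots> < i\<^sub>r\<close> in which they are taken depend on the degree only, so by uniqueness of
  factorisation \<open>\<psi>\<close> commutes with all face maps (\<open>map_face0\<close>, \<open>map_face1\<close>).  Hence the linear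
  extension of \<open>\<psi>\<close> is a chain map (\<open>bd_pushforward\<close>): it preserves cycles and boundaries.

  On the algebraic side, \<open>homology k r \<Lambda>\<close> is realised inside \<open>C\<^sub>r/B\<^sub>r\<close>, the quotient of all
  \<open>r\<close>-chains by the boundaries: it is the image of the group of cycles under the projection
  \<open>C\<^sub>r \<rightarrow> C\<^sub>r/B\<^sub>r\<close>.  It is thus an abelian group as a subgroup of \<open>C\<^sub>r/B\<^sub>r\<close>, and its induced
  homomorphisms are restrictions of those between the groups \<open>C\<^sub>r/B\<^sub>r\<close> (\<open>comm_group_subquotient\<close>, \<open>subquotient_hom\<close>).  Since every
  homology class is represented by a cycle, an induced map is determined by its values on classes
  of cycles (\<open>homology_map_eqI\<close>), so functoriality reduces to the identities
  \<open>id\<^sub># = id\<close> and \<open>(\<phi> \<circ> \<psi>)\<^sub># = \<phi>\<^sub># \<circ> \<psi>\<^sub>#\<close> for chains.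
\<close>


section \<open>Subquotients of abelian groups\<close>

text \<open>
  Cosets and their products do not refer to the carrier of the ambient group, so forming cosets
  of \<open>B\<close> in the group \<open>Z\<close> gives the same sets as forming them in \<open>G\<close>.
\<close>

lemma subquotient_eq:
  "G\<lparr>carrier := Z\<rparr> Mod B = (G Mod B)\<lparr>carrier := (\<lambda>z. B #>\<^bsub>G\<^esub> z) ` Z\<rparr>"
  by (simp add: FactGroup_def RCOSETS_def r_coset_def set_mult_def fun_eq_iff UNION_singleton_eq_range)

lemma carrier_subquotient:
  "carrier (G\<lparr>carrier := Z\<rparr> Mod B) = (\<lambda>z. B #>\<^bsub>G\<^esub> z) ` Z"
  by (simp add: subquotient_eq)

lemma comm_group_subquotient:
  assumes "comm_group G" "subgroup B G" "subgroup Z G"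
  shows "comm_group (G\<lparr>carrier := Z\<rparr> Mod B)"
proof -
  interpret G: comm_group G by fact
  interpret Q: comm_group "G Mod B"
    using assms(2) by (rule G.abelian_FactGroup)
  interpret B: normal B G
    using assms(2) by (rule G.subgroup_imp_normal)
  interpret p: group_hom G "G Mod B" "\<lambda>z. B #>\<^bsub>G\<^esub> z"
    by (simp add: B.r_coset_hom_Mod G.is_group Q.is_group group_hom.intro group_hom_axioms.intro)
  have "subgroup ((\<lambda>z. B #>\<^bsub>G\<^esub> z) ` Z) (G Mod B)"
    using assms(3) by (rule p.subgroup_img_is_subgroup)
  then have "group ((G Mod B)\<lparr>carrier := (\<lambda>z. B #>\<^bsub>G\<^esub> z) ` Z\<rparr>)"
    and "(\<lambda>z. B #>\<^bsub>G\<^esub> z) ` Z \<subseteq> carrier (G Mod B)"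
    by (simp_all add: Q.subgroup_imp_group subgroup.subset)
  then show ?thesis
    unfolding subquotient_eq using Q.m_comm
    by (intro group.group_comm_groupI) (auto simp: subset_iff)
qed

text \<open>
  The composite of \<open>f\<close> with the projection \<open>G' \<rightarrow> G'/B'\<close> kills \<open>B\<close> and therefore factors through
  \<open>G/B\<close>; the map on subquotients is the restriction of the factor to the classes of \<open>Z\<close>.
\<close>

lemma subquotient_hom:
  assumes "comm_group G" "subgroup B G" "subgroup Z G"
    and "comm_group G'" "subgroup B' G'"
    and f: "f \<in> hom G G'" "f ` B \<subseteq> B'" "f ` Z \<subseteq> Z'"
  obtains g where "g \<in> hom (G\<lparr>carrier := Z\<rparr> Mod B) (G'\<lparr>carrier := Z'\<rparr> Mod B')"
    and "\<And>z. z \<in> Z \<Longrightarrow> g (B #>\<^bsub>G\<^esub> z) = B' #>\<^bsub>G'\<^esub> f z"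
proof -
  interpret G: comm_group G by fact
  interpret G': comm_group G' by fact
  interpret Q': comm_group "G' Mod B'"
    using assms(5) by (rule G'.abelian_FactGroup)
  interpret B: normal B G
    using assms(2) by (rule G.subgroup_imp_normal)
  interpret B': normal B' G'
    using assms(5) by (rule G'.subgroup_imp_normal)
  have "(\<lambda>z. B' #>\<^bsub>G'\<^esub> z) \<circ> f \<in> hom G (G' Mod B')"
    using f(1) B'.r_coset_hom_Mod by (rule hom_compose)
  then interpret pf: group_hom G "G' Mod B'" "\<lambda>z. B' #>\<^bsub>G'\<^esub> f z"
    by (simp add: group_hom.intro group_hom_axioms.intro G.is_group Q'.is_group comp_def)
  have "B \<subseteq> kernel G (G' Mod B') (\<lambda>z. B' #>\<^bsub>G'\<^esub> f z)"
    using f(2) assms(5) B.subset by (auto simp: kernel_def image_subset_iff G'.coset_join2 subgroup.mem_carrier)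
  then obtain g where g: "g \<in> hom (G Mod B) (G' Mod B')"
      "\<And>z. z \<in> carrier G \<Longrightarrow> g (B #>\<^bsub>G\<^esub> z) = B' #>\<^bsub>G'\<^esub> f z"
    using pf.FactGroup_universal_kernel B.normal_axioms by blast
  have Z: "Z \<subseteq> carrier G"
    using assms(3) by (rule subgroup.subset)
  have "g \<in> hom (G\<lparr>carrier := Z\<rparr> Mod B) (G'\<lparr>carrier := Z'\<rparr> Mod B')"
  proof (rule homI)
    fix X assume "X \<in> carrier (G\<lparr>carrier := Z\<rparr> Mod B)"
    then show "g X \<in> carrier (G'\<lparr>carrier := Z'\<rparr> Mod B')"
      using g(2) Z f(3) unfolding carrier_subquotient by blast
  next
    fix X Y assume "X \<in> carrier (G\<lparr>carrier := Z\<rparr> Mod B)" "Y \<in> carrier (G\<lparr>carrier := Z\<rparr> Mod B)"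
    then have "X \<in> carrier (G Mod B)" "Y \<in> carrier (G Mod B)"
      using Z by (auto simp: carrier_subquotient carrier_FactGroup)
    then show "g (X \<otimes>\<^bsub>G\<lparr>carrier := Z\<rparr> Mod B\<^esub> Y) = g X \<otimes>\<^bsub>G'\<lparr>carrier := Z'\<rparr> Mod B'\<^esub> g Y"
      using hom_mult[OF g(1)] by (simp add: subquotient_eq)
  qed
  then show thesis
    using that g(2) Z by blast
qed


section \<open>Faces of cubes\<close>

lemma Nk_ones_apply: "Nk_ones k i = (if i < k then 1 else 0)"
  by (simp add: Nk_ones_def Nk_unit_def)

lemma Nk_unit_mem: "i < k \<Longrightarrow> Nk_unit i \<in> Nk k"
  by (auto simp: Nk_unit_def Nk_def)

lemma cube_deg_le_1: "x \<in> cubes k r \<Lambda> \<Longrightarrow> deg \<Lambda> x i \<le> 1"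
  by (auto simp: cubes_def le_fun_def Nk_ones_apply split: if_splits dest: spec[of _ i])

text \<open>
  All coordinates of the degree of a cube are 0 or 1, so the number \<open>r\<close>, the sum of the coordinates,
  also counts the nonzero ones; hence \<open>cube_dir\<close> picks a valid entry of the list of directions.
\<close>

lemma cube_dir:
  assumes x: "x \<in> cubes k r \<Lambda>" and j: "j \<in> {1..r}"
  shows "cube_dir k \<Lambda> x j < k" and "deg \<Lambda> x (cube_dir k \<Lambda> x j) = 1"
proof -
  let ?I = "{i. i < k \<and> deg \<Lambda> x i \<noteq> 0}"
  have "r = (\<Sum>i<k. deg \<Lambda> x i)"
    using x by (simp add: cubes_def Nk_length_def)
  also have "\<dots> = (\<Sum>i\<in>?I. deg \<Lambda> x i)"
    by (rule sum.mono_neutral_right) auto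
  also have "\<dots> = (\<Sum>i\<in>?I. 1)"
  proof (rule sum.cong)
    fix i assume "i \<in> ?I"
    then show "deg \<Lambda> x i = 1"
      using cube_deg_le_1[OF x, of i] by simp
  qed simp
  finally have "card ?I = r" by simp
  then have "cube_dir k \<Lambda> x j \<in> set (sorted_list_of_set ?I)"
    unfolding cube_dir_def using j by (intro nth_mem) auto
  then show "cube_dir k \<Lambda> x j < k" "deg \<Lambda> x (cube_dir k \<Lambda> x j) = 1"
    using cube_deg_le_1[OF x, of "cube_dir k \<Lambda> x j"] by auto
qed

context kgraph
begin

lemma cube_of_codim_1:
  assumes "x \<in> cubes k r \<Lambda>" "i < k" "\<mu> \<in> arrows \<Lambda>"
    and deg: "deg \<Lambda> x = (\<lambda>l. deg \<Lambda> \<mu> l + Nk_unit i l)"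
  shows "\<mu> \<in> cubes k (r - 1) \<Lambda>"
proof -
  have "deg \<Lambda> \<mu> \<le> deg \<Lambda> x"
    by (simp add: deg le_fun_def)
  moreover have "Nk_length k (deg \<Lambda> x) = Nk_length k (deg \<Lambda> \<mu>) + 1"
    using assms(2) by (simp add: deg Nk_length_def sum.distrib Nk_unit_def)
  ultimately show ?thesis
    using assms(1,3) by (auto simp: cubes_def)
qed

text \<open>
  Prescribing the degree \<open>e\<^sub>i\<close> of one factor of \<open>x\<close> prescribes the degree of the other one as well,
  so the factorisation property applies.
\<close>

lemma face0_ex1:
  assumes x: "x \<in> cubes k r \<Lambda>" and i: "i < k" "deg \<Lambda> x i = 1"
  shows "\<exists>!\<mu>. \<mu> \<in> cubes k (r - 1) \<Lambda> \<and>
     (\<exists>\<beta> \<in> arrows \<Lambda>. deg \<Lambda> \<beta> = Nk_unit i \<and> src \<Lambda> \<mu> = rng \<Lambda> \<beta> \<and> mor_comp \<Lambda> \<mu> \<beta> = x)"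
    (is "\<exists>!\<mu>. ?P \<mu>")
proof -
  define m where "m = (\<lambda>l. deg \<Lambda> x l - Nk_unit i l)"
  have xa: "x \<in> arrows \<Lambda>" using x by (simp add: cubes_def)
  have m: "deg \<Lambda> x = (\<lambda>l. m l + Nk_unit i l)"
    using i(2) by (auto simp: m_def Nk_unit_def)
  have "m \<in> Nk k"
    using deg_Nk[OF xa] by (simp add: m_def Nk_def)
  from factorisation[OF xa this Nk_unit_mem[OF i(1)] m]
  obtain \<mu> \<nu> where fac: "\<mu> \<in> arrows \<Lambda>" "\<nu> \<in> arrows \<Lambda>" "src \<Lambda> \<mu> = rng \<Lambda> \<nu>"
      "deg \<Lambda> \<mu> = m" "deg \<Lambda> \<nu> = Nk_unit i" "x = mor_comp \<Lambda> \<mu> \<nu>"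
    and uniq: "\<And>\<mu>' \<nu>'. \<mu>' \<in> arrows \<Lambda> \<and> \<nu>' \<in> arrows \<Lambda> \<and> src \<Lambda> \<mu>' = rng \<Lambda> \<nu>' \<and>
        deg \<Lambda> \<mu>' = m \<and> deg \<Lambda> \<nu>' = Nk_unit i \<and> x = mor_comp \<Lambda> \<mu>' \<nu>' \<Longrightarrow> \<mu>' = \<mu>"
    by (auto simp: Ex1_def)
  show ?thesis
  proof
    show "?P \<mu>"
      using fac m cube_of_codim_1[OF x i(1) fac(1)] by auto
    fix \<mu>' assume "?P \<mu>'"
    then obtain \<beta> where \<beta>: "\<mu>' \<in> arrows \<Lambda>" "\<beta> \<in> arrows \<Lambda>" "deg \<Lambda> \<beta> = Nk_unit i"
        "src \<Lambda> \<mu>' = rng \<Lambda> \<beta>" "x = mor_comp \<Lambda> \<mu>' \<beta>"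
      by (auto simp: cubes_def)
    have "deg \<Lambda> \<mu>' = m"
      using deg_comp[OF \<beta>(1,2,4)] \<beta>(3,5) by (auto simp: m_def)
    with \<beta> show "\<mu>' = \<mu>" using uniq by blast
  qed
qed

lemma face1_ex1:
  assumes x: "x \<in> cubes k r \<Lambda>" and i: "i < k" "deg \<Lambda> x i = 1"
  shows "\<exists>!\<mu>. \<mu> \<in> cubes k (r - 1) \<Lambda> \<and>
     (\<exists>\<alpha> \<in> arrows \<Lambda>. deg \<Lambda> \<alpha> = Nk_unit i \<and> src \<Lambda> \<alpha> = rng \<Lambda> \<mu> \<and> mor_comp \<Lambda> \<alpha> \<mu> = x)"
    (is "\<exists>!\<mu>. ?P \<mu>")
proof -
  define m where "m = (\<lambda>l. deg \<Lambda> x l - Nk_unit i l)"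
  have xa: "x \<in> arrows \<Lambda>" using x by (simp add: cubes_def)
  have m: "deg \<Lambda> x = (\<lambda>l. Nk_unit i l + m l)"
    using i(2) by (auto simp: m_def Nk_unit_def)
  have "m \<in> Nk k"
    using deg_Nk[OF xa] by (simp add: m_def Nk_def)
  from factorisation[OF xa Nk_unit_mem[OF i(1)] this m]
  obtain \<alpha> \<mu> where fac: "\<alpha> \<in> arrows \<Lambda>" "\<mu> \<in> arrows \<Lambda>" "src \<Lambda> \<alpha> = rng \<Lambda> \<mu>"
      "deg \<Lambda> \<alpha> = Nk_unit i" "deg \<Lambda> \<mu> = m" "x = mor_comp \<Lambda> \<alpha> \<mu>"
    and uniq: "\<And>\<alpha>' \<mu>'. \<alpha>' \<in> arrows \<Lambda> \<and> \<mu>' \<in> arrows \<Lambda> \<and> src \<Lambda> \<alpha>' = rng \<Lambda> \<mu>' \<and>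
        deg \<Lambda> \<alpha>' = Nk_unit i \<and> deg \<Lambda> \<mu>' = m \<and> x = mor_comp \<Lambda> \<alpha>' \<mu>' \<Longrightarrow> \<mu>' = \<mu>"
    by (auto simp: Ex1_def)
  show ?thesis
  proof
    show "?P \<mu>"
      using fac m cube_of_codim_1[OF x i(1) fac(2)] by (auto simp: add.commute)
    fix \<mu>' assume "?P \<mu>'"
    then obtain \<alpha>' where \<alpha>': "\<alpha>' \<in> arrows \<Lambda>" "\<mu>' \<in> arrows \<Lambda>" "deg \<Lambda> \<alpha>' = Nk_unit i"
        "src \<Lambda> \<alpha>' = rng \<Lambda> \<mu>'" "x = mor_comp \<Lambda> \<alpha>' \<mu>'"
      by (auto simp: cubes_def)
    have "deg \<Lambda> \<mu>' = m"
      using deg_comp[OF \<alpha>'(1,2,4)] \<alpha>'(3,5) by (auto simp: m_def)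
    with \<alpha>' show "\<mu>' = \<mu>" using uniq by blast
  qed
qed

lemma face0_props:
  assumes "x \<in> cubes k r \<Lambda>" "j \<in> {1..r}"
  shows "face0 k r \<Lambda> j x \<in> cubes k (r - 1) \<Lambda> \<and>
     (\<exists>\<beta> \<in> arrows \<Lambda>. deg \<Lambda> \<beta> = Nk_unit (cube_dir k \<Lambda> x j) \<and>
        src \<Lambda> (face0 k r \<Lambda> j x) = rng \<Lambda> \<beta> \<and> mor_comp \<Lambda> (face0 k r \<Lambda> j x) \<beta> = x)"
  unfolding face0_def by (rule theI', rule face0_ex1[OF assms(1) cube_dir[OF assms]])

lemma face1_props:
  assumes "x \<in> cubes k r \<Lambda>" "j \<in> {1..r}"
  shows "face1 k r \<Lambda> j x \<in> cubes k (r - 1) \<Lambda> \<and>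
     (\<exists>\<alpha> \<in> arrows \<Lambda>. deg \<Lambda> \<alpha> = Nk_unit (cube_dir k \<Lambda> x j) \<and>
        src \<Lambda> \<alpha> = rng \<Lambda> (face1 k r \<Lambda> j x) \<and> mor_comp \<Lambda> \<alpha> (face1 k r \<Lambda> j x) = x)"
  unfolding face1_def by (rule theI', rule face1_ex1[OF assms(1) cube_dir[OF assms]])

lemma face_in_cubes:
  "x \<in> cubes k r \<Lambda> \<Longrightarrow> j \<in> {1..r} \<Longrightarrow> face k r \<Lambda> l j x \<in> cubes k (r - 1) \<Lambda>"
  using face0_props face1_props by (simp add: face_def)

end

context kgraph_morphism
begin

lemma map_cubes: "x \<in> cubes k r \<Lambda>1 \<Longrightarrow> \<psi> x \<in> cubes k r \<Lambda>2"
  by (simp add: cubes_def map_arrows map_deg)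

lemma map_cube_dir: "x \<in> cubes k r \<Lambda>1 \<Longrightarrow> cube_dir k \<Lambda>2 (\<psi> x) j = cube_dir k \<Lambda>1 x j"
  by (simp add: cubes_def cube_dir_def map_deg)

text \<open>
  The image of the factorisation defining a face of \<open>x\<close> is a factorisation of \<open>\<psi> x\<close> with the degrees
  required of the corresponding face of \<open>\<psi> x\<close>.
\<close>

lemma map_face0:
  assumes x: "x \<in> cubes k r \<Lambda>1" and j: "j \<in> {1..r}"
  shows "face0 k r \<Lambda>2 j (\<psi> x) = \<psi> (face0 k r \<Lambda>1 j x)"
proof -
  let ?\<mu> = "face0 k r \<Lambda>1 j x"
  obtain \<beta> where \<beta>: "\<beta> \<in> arrows \<Lambda>1" "deg \<Lambda>1 \<beta> = Nk_unit (cube_dir k \<Lambda>1 x j)"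
      "src \<Lambda>1 ?\<mu> = rng \<Lambda>1 \<beta>" "mor_comp \<Lambda>1 ?\<mu> \<beta> = x" and \<mu>: "?\<mu> \<in> cubes k (r - 1) \<Lambda>1"
    using dom.face0_props[OF x j] by auto
  have \<mu>a: "?\<mu> \<in> arrows \<Lambda>1" using \<mu> by (simp add: cubes_def)
  show ?thesis
    unfolding face0_def[of k r \<Lambda>2]
  proof (rule the1_equality[OF cod.face0_ex1[OF map_cubes[OF x] cube_dir[OF map_cubes[OF x] j]]],
      intro conjI bexI[of _ "\<psi> \<beta>"])
    show "src \<Lambda>2 (\<psi> ?\<mu>) = rng \<Lambda>2 (\<psi> \<beta>)"
      using map_src[OF \<mu>a] map_rng[OF \<beta>(1)] \<beta>(3) by simp
    show "mor_comp \<Lambda>2 (\<psi> ?\<mu>) (\<psi> \<beta>) = \<psi> x"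
      using map_comp[OF \<mu>a \<beta>(1,3)] \<beta>(4) by simp
  qed (use \<mu> \<beta> x in \<open>simp_all add: map_cubes map_arrows map_deg map_cube_dir\<close>)
qed

lemma map_face1:
  assumes x: "x \<in> cubes k r \<Lambda>1" and j: "j \<in> {1..r}"
  shows "face1 k r \<Lambda>2 j (\<psi> x) = \<psi> (face1 k r \<Lambda>1 j x)"
proof -
  let ?\<mu> = "face1 k r \<Lambda>1 j x"
  obtain \<alpha> where \<alpha>: "\<alpha> \<in> arrows \<Lambda>1" "deg \<Lambda>1 \<alpha> = Nk_unit (cube_dir k \<Lambda>1 x j)"
      "src \<Lambda>1 \<alpha> = rng \<Lambda>1 ?\<mu>" "mor_comp \<Lambda>1 \<alpha> ?\<mu> = x" and \<mu>: "?\<mu> \<in> cubes k (r - 1) \<Lambda>1"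
    using dom.face1_props[OF x j] by auto
  have \<mu>a: "?\<mu> \<in> arrows \<Lambda>1" using \<mu> by (simp add: cubes_def)
  show ?thesis
    unfolding face1_def[of k r \<Lambda>2]
  proof (rule the1_equality[OF cod.face1_ex1[OF map_cubes[OF x] cube_dir[OF map_cubes[OF x] j]]],
      intro conjI bexI[of _ "\<psi> \<alpha>"])
    show "src \<Lambda>2 (\<psi> \<alpha>) = rng \<Lambda>2 (\<psi> ?\<mu>)"
      using map_src[OF \<alpha>(1)] map_rng[OF \<mu>a] \<alpha>(3) by simp
    show "mor_comp \<Lambda>2 (\<psi> \<alpha>) (\<psi> ?\<mu>) = \<psi> x"
      using map_comp[OF \<alpha>(1) \<mu>a \<alpha>(3)] \<alpha>(4) by simp
  qed (use \<mu> \<alpha> x in \<open>simp_all add: map_cubes map_arrows map_deg map_cube_dir\<close>)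
qed

lemma map_face:
  "x \<in> cubes k r \<Lambda>1 \<Longrightarrow> j \<in> {1..r} \<Longrightarrow> face k r \<Lambda>2 l j (\<psi> x) = \<psi> (face k r \<Lambda>1 l j x)"
  by (simp add: face_def map_face0 map_face1)

end


section \<open>The induced chain map\<close>

lemma frag_extend_in_free_Abelian_group:
  assumes "\<And>x. x \<in> S \<Longrightarrow> f x \<in> carrier (free_Abelian_group T)"
    and "c \<in> carrier (free_Abelian_group S)"
  shows "frag_extend f c \<in> carrier (free_Abelian_group T)"
  using assms keys_frag_extend[of f c] by fastforce

lemma frag_extend_hom:
  assumes "\<And>x. x \<in> S \<Longrightarrow> f x \<in> carrier (free_Abelian_group T)"
  shows "frag_extend f \<in> hom (free_Abelian_group S) (free_Abelian_group T)"
proof (rule homI)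
  fix c assume "c \<in> carrier (free_Abelian_group S)"
  with assms show "frag_extend f c \<in> carrier (free_Abelian_group T)"
    by (rule frag_extend_in_free_Abelian_group)
qed (simp add: frag_extend_add)

lemma pushforward_id: "pushforward id c = c"
  by (simp add: pushforward_def flip: frag_expansion)

lemma pushforward_comp: "pushforward (\<phi> \<circ> \<psi>) c = pushforward \<phi> (pushforward \<psi> c)"
  using frag_extend_compose[of "\<lambda>x. frag_of (\<phi> x)" \<psi>] by (simp add: pushforward_def fun_eq_iff comp_def)

lemma pushforward_cong:
  assumes "\<And>x. x \<in> Poly_Mapping.keys c \<Longrightarrow> \<phi> x = \<psi> x"
  shows "pushforward \<phi> c = pushforward \<psi> c"
  unfolding pushforward_def by (rule frag_extend_eq) (simp add: assms)

context kgraph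
begin

lemma bd_hom: "bd k (Suc r) \<Lambda> \<in> hom (chain_group k (Suc r) \<Lambda>) (chain_group k r \<Lambda>)"
  unfolding bd_def
proof (intro frag_extend_hom sum_closed_free_Abelian_group)
  fix x l i assume "x \<in> cubes k (Suc r) \<Lambda>" "i \<in> {1..Suc r}"
  then show "frag_cmul ((-1) ^ (i + l)) (frag_of (face k (Suc r) \<Lambda> l i x)) \<in> carrier (chain_group k r \<Lambda>)"
    using face_in_cubes[of x "Suc r" i l] keys_cmul by (fastforce simp: keys_frag_of)
qed

lemma subgroup_boundaries: "subgroup (boundaries k r \<Lambda>) (chain_group k r \<Lambda>)"
  unfolding boundaries_def
  by (rule group_hom.img_is_subgroup) (simp add: group_hom.intro group_hom_axioms.intro bd_hom)

lemma subgroup_cycles: "subgroup (cycles k r \<Lambda>) (chain_group k r \<Lambda>)"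
proof (cases r)
  case 0
  \<comment> \<open>The boundary operator vanishes in dimension 0, so that all 0-chains are cycles.\<close>
  have "bd k 0 \<Lambda> c = 0" for c
    by (simp add: bd_def frag_extend_eq_0)
  then have "cycles k r \<Lambda> = carrier (chain_group k r \<Lambda>)"
    by (auto simp: 0 cycles_def kernel_def)
  then show ?thesis by (simp add: group.subgroup_self)
next
  case (Suc r')
  then show ?thesis
    unfolding cycles_def
    by (intro group_hom.subgroup_kernel)
      (simp add: group_hom.intro group_hom_axioms.intro bd_hom)
qed

end

context kgraph_morphism
begin

lemma pushforward_hom: "pushforward \<psi> \<in> hom (chain_group k r \<Lambda>1) (chain_group k r \<Lambda>2)"
  unfolding pushforward_def by (rule frag_extend_hom) (simp add: map_cubes)

text \<open>
  Both sides are additive in \<open>c\<close>, so it suffices to compare them on a single cube, where the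
  identity is compatibility with face maps, summand by summand.
\<close>

lemma bd_pushforward:
  assumes "c \<in> carrier (chain_group k r \<Lambda>1)"
  shows "bd k r \<Lambda>2 (pushforward \<psi> c) = pushforward \<psi> (bd k r \<Lambda>1 c)"
proof -
  have "Poly_Mapping.keys c \<subseteq> cubes k r \<Lambda>1" using assms by simp
  then show ?thesis
  proof (induction c rule: frag_induction)
    case (one x)
    then show ?case
      by (simp add: bd_def pushforward_def frag_extend_sum frag_extend_add frag_extend_cmul
          map_face[simplified])
  qed (simp_all add: bd_def pushforward_def frag_extend_diff)
qed

lemma pushforward_cycles: "pushforward \<psi> ` cycles k r \<Lambda>1 \<subseteq> cycles k r \<Lambda>2"
proof
  fix c' assume "c' \<in> pushforward \<psi> ` cycles k r \<Lambda>1"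
  then obtain c where c: "c' = pushforward \<psi> c" "c \<in> carrier (chain_group k r \<Lambda>1)" "bd k r \<Lambda>1 c = 0"
    by (auto simp: cycles_def kernel_def)
  moreover have "bd k r \<Lambda>2 c' = 0"
    using bd_pushforward[OF c(2)] c(1,3) by (simp add: pushforward_def)
  ultimately show "c' \<in> cycles k r \<Lambda>2"
    using hom_in_carrier[OF pushforward_hom c(2)] by (simp add: cycles_def kernel_def)
qed

lemma pushforward_boundaries: "pushforward \<psi> ` boundaries k r \<Lambda>1 \<subseteq> boundaries k r \<Lambda>2"
proof
  fix b' assume "b' \<in> pushforward \<psi> ` boundaries k r \<Lambda>1"
  then obtain c where c: "c \<in> carrier (chain_group k (Suc r) \<Lambda>1)"
      and b': "b' = pushforward \<psi> (bd k (Suc r) \<Lambda>1 c)"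
    by (auto simp: boundaries_def)
  have "b' = bd k (Suc r) \<Lambda>2 (pushforward \<psi> c)"
    using b' bd_pushforward[OF c] by simp
  then show "b' \<in> boundaries k r \<Lambda>2"
    unfolding boundaries_def using hom_in_carrier[OF pushforward_hom c] by (rule image_eqI)
qed

end


section \<open>The induced map on homology\<close>

lemma homology_eq:
  "homology k r \<Lambda> = (chain_group k r \<Lambda>)\<lparr>carrier := cycles k r \<Lambda>\<rparr> Mod boundaries k r \<Lambda>"
  by (simp add: homology_def cycle_group_def)

lemma homology_class_eq: "homology_class k r \<Lambda> c = boundaries k r \<Lambda> #>\<^bsub>chain_group k r \<Lambda>\<^esub> c"
  by (simp add: homology_class_def cycle_group_def r_coset_def)

lemma carrier_homology: "carrier (homology k r \<Lambda>) = homology_class k r \<Lambda> ` cycles k r \<Lambda>"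
  by (simp add: homology_eq homology_class_eq carrier_subquotient)

lemma (in kgraph) comm_group_homology: "comm_group (homology k r \<Lambda>)"
  unfolding homology_eq
  by (intro comm_group_subquotient abelian_free_Abelian_group subgroup_boundaries subgroup_cycles)

context kgraph_morphism
begin

lemma homology_map_unique:
  assumes "\<And>c. c \<in> cycles k r \<Lambda>1 \<Longrightarrow> f (homology_class k r \<Lambda>1 c) = homology_class k r \<Lambda>2 (pushforward \<psi> c)"
    and "\<And>c. c \<in> cycles k r \<Lambda>1 \<Longrightarrow> g (homology_class k r \<Lambda>1 c) = homology_class k r \<Lambda>2 (pushforward \<psi> c)"
    and "X \<in> carrier (homology k r \<Lambda>1)"
  shows "f X = g X"
  using assms by (auto simp: carrier_homology)

text \<open>
  The description in \<open>homology_map\<close> is satisfied by exactly one function: existence is the induced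
  map of subquotients, truncated to the carrier, and uniqueness holds because every homology class
  is the class of a cycle.
\<close>

lemma homology_map:
  shows homology_map_hom: "homology_map k r \<Lambda>1 \<Lambda>2 \<psi> \<in> hom (homology k r \<Lambda>1) (homology k r \<Lambda>2)"
    and homology_map_extensional:
      "homology_map k r \<Lambda>1 \<Lambda>2 \<psi> \<in> extensional (carrier (homology k r \<Lambda>1))"
    and homology_map_class: "c \<in> cycles k r \<Lambda>1 \<Longrightarrow>
      homology_map k r \<Lambda>1 \<Lambda>2 \<psi> (homology_class k r \<Lambda>1 c) = homology_class k r \<Lambda>2 (pushforward \<psi> c)"
proof -
  let ?H1 = "homology k r \<Lambda>1" and ?H2 = "homology k r \<Lambda>2"
  let ?P = "\<lambda>f. f \<in> hom ?H1 ?H2 \<inter> extensional (carrier ?H1) \<and>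
    (\<forall>c \<in> cycles k r \<Lambda>1. f (homology_class k r \<Lambda>1 c) = homology_class k r \<Lambda>2 (pushforward \<psi> c))"
  interpret H1: comm_group ?H1 by (rule dom.comm_group_homology)
  obtain g where g: "g \<in> hom ?H1 ?H2"
      "\<And>c. c \<in> cycles k r \<Lambda>1 \<Longrightarrow> g (homology_class k r \<Lambda>1 c) = homology_class k r \<Lambda>2 (pushforward \<psi> c)"
    unfolding homology_eq homology_class_eq
    using subquotient_hom[OF abelian_free_Abelian_group dom.subgroup_boundaries dom.subgroup_cycles
        abelian_free_Abelian_group cod.subgroup_boundaries
        pushforward_hom pushforward_boundaries pushforward_cycles]
    by blast
  have "\<exists>!f. ?P f"
  proof
    show "?P (restrict g (carrier ?H1))"
    proof (intro conjI ballI IntI)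
      show "restrict g (carrier ?H1) \<in> hom ?H1 ?H2"
        using g(1) by (auto simp: hom_def)
    qed (simp_all add: carrier_homology g(2))
    fix f assume "?P f"
    then show "f = restrict g (carrier ?H1)"
      using homology_map_unique[of r f g] g(2) by (intro extensionalityI[of _ "carrier ?H1"]) auto
  qed
  then have "?P (homology_map k r \<Lambda>1 \<Lambda>2 \<psi>)"
    unfolding homology_map_def by (rule theI')
  then show "homology_map k r \<Lambda>1 \<Lambda>2 \<psi> \<in> hom ?H1 ?H2"
    "homology_map k r \<Lambda>1 \<Lambda>2 \<psi> \<in> extensional (carrier ?H1)"
    "c \<in> cycles k r \<Lambda>1 \<Longrightarrow>
      homology_map k r \<Lambda>1 \<Lambda>2 \<psi> (homology_class k r \<Lambda>1 c) = homology_class k r \<Lambda>2 (pushforward \<psi> c)"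
    by auto
qed

lemma homology_map_eqI:
  assumes "f \<in> extensional (carrier (homology k r \<Lambda>1))"
    and "\<And>c. c \<in> cycles k r \<Lambda>1 \<Longrightarrow> f (homology_class k r \<Lambda>1 c) = homology_class k r \<Lambda>2 (pushforward \<psi> c)"
  shows "homology_map k r \<Lambda>1 \<Lambda>2 \<psi> = f"
  using homology_map_extensional assms(1) homology_map_unique[OF homology_map_class assms(2)]
  by (rule extensionalityI)

end


section \<open>Functoriality\<close>

lemma keys_cycle: "c \<in> cycles k r \<Lambda> \<Longrightarrow> x \<in> Poly_Mapping.keys c \<Longrightarrow> x \<in> arrows \<Lambda>"
  by (auto simp: cycles_def kernel_def cubes_def)

text \<open>
  Composition in the category of \<open>k\<close>-graphs truncates the composite to the arrow set.  The two
  congruence lemmas below allow truncated and untruncated functions to be exchanged.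
\<close>

lemma kgraph_morphism_cong:
  assumes "kgraph_morphism k \<Lambda>1 \<Lambda>2 \<psi>" and "\<And>x. x \<in> arrows \<Lambda>1 \<Longrightarrow> \<phi> x = \<psi> x"
  shows "kgraph_morphism k \<Lambda>1 \<Lambda>2 \<phi>"
proof -
  interpret kgraph_morphism k \<Lambda>1 \<Lambda>2 \<psi> by fact
  show ?thesis
    by unfold_locales
      (simp_all add: assms(2) dom.src_closed dom.rng_closed dom.comp_closed map_arrows map_src map_rng
        map_comp map_deg)
qed

lemma kgraph_morphism_id: "kgraph k \<Lambda> \<Longrightarrow> kgraph_morphism k \<Lambda> \<Lambda> id"
  by (simp add: kgraph_morphism_def kgraph_morphism_axioms_def)

lemma kgraph_morphism_comp:
  assumes "kgraph_morphism k \<Lambda>1 \<Lambda>2 \<psi>" and "kgraph_morphism k \<Lambda>2 \<Lambda>3 \<phi>"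
  shows "kgraph_morphism k \<Lambda>1 \<Lambda>3 (\<phi> \<circ> \<psi>)"
proof -
  interpret \<psi>: kgraph_morphism k \<Lambda>1 \<Lambda>2 \<psi> by fact
  interpret \<phi>: kgraph_morphism k \<Lambda>2 \<Lambda>3 \<phi> by fact
  have "src \<Lambda>2 (\<psi> \<mu>) = rng \<Lambda>2 (\<psi> \<nu>)"
    if "\<mu> \<in> arrows \<Lambda>1" "\<nu> \<in> arrows \<Lambda>1" "src \<Lambda>1 \<mu> = rng \<Lambda>1 \<nu>" for \<mu> \<nu>
    using that by (simp flip: \<psi>.map_src \<psi>.map_rng)
  then show ?thesis
    by unfold_locales
      (simp_all add: \<psi>.map_arrows \<psi>.map_src \<psi>.map_rng \<psi>.map_comp \<psi>.map_deg
        \<phi>.map_arrows \<phi>.map_src \<phi>.map_rng \<phi>.map_comp \<phi>.map_deg)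
qed

lemma kgraph_morphism_compose:
  assumes "kgraph_morphism k \<Lambda>1 \<Lambda>2 \<psi>" and "kgraph_morphism k \<Lambda>2 \<Lambda>3 \<phi>"
  shows "kgraph_morphism k \<Lambda>1 \<Lambda>3 (compose (arrows \<Lambda>1) \<phi> \<psi>)"
  using kgraph_morphism_comp[OF assms] by (rule kgraph_morphism_cong) (simp add: compose_eq)

lemma homology_map_cong:
  assumes "kgraph_morphism k \<Lambda>1 \<Lambda>2 \<psi>" and eq: "\<And>x. x \<in> arrows \<Lambda>1 \<Longrightarrow> \<phi> x = \<psi> x"
  shows "homology_map k r \<Lambda>1 \<Lambda>2 \<phi> = homology_map k r \<Lambda>1 \<Lambda>2 \<psi>"
proof -
  interpret \<psi>: kgraph_morphism k \<Lambda>1 \<Lambda>2 \<psi> by fact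
  interpret \<phi>: kgraph_morphism k \<Lambda>1 \<Lambda>2 \<phi> using assms by (rule kgraph_morphism_cong)
  show ?thesis
  proof (rule \<phi>.homology_map_eqI[OF \<psi>.homology_map_extensional])
    fix c assume c: "c \<in> cycles k r \<Lambda>1"
    then have "pushforward \<phi> c = pushforward \<psi> c"
      by (intro pushforward_cong eq keys_cycle)
    with c show "homology_map k r \<Lambda>1 \<Lambda>2 \<psi> (homology_class k r \<Lambda>1 c)
        = homology_class k r \<Lambda>2 (pushforward \<phi> c)"
      by (simp add: \<psi>.homology_map_class)
  qed
qed

lemma homology_map_id:
  assumes "kgraph k \<Lambda>"
  shows "homology_map k r \<Lambda> \<Lambda> id = restrict id (carrier (homology k r \<Lambda>))"
proof -
  interpret kgraph_morphism k \<Lambda> \<Lambda> id using assms by (rule kgraph_morphism_id)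
  show ?thesis
    by (rule homology_map_eqI) (auto simp: carrier_homology pushforward_id)
qed

lemma homology_map_comp:
  assumes "kgraph_morphism k \<Lambda>1 \<Lambda>2 \<psi>" and "kgraph_morphism k \<Lambda>2 \<Lambda>3 \<phi>"
  shows "homology_map k r \<Lambda>1 \<Lambda>3 (\<phi> \<circ> \<psi>)
    = compose (carrier (homology k r \<Lambda>1)) (homology_map k r \<Lambda>2 \<Lambda>3 \<phi>) (homology_map k r \<Lambda>1 \<Lambda>2 \<psi>)"
proof -
  interpret \<psi>: kgraph_morphism k \<Lambda>1 \<Lambda>2 \<psi> by fact
  interpret \<phi>: kgraph_morphism k \<Lambda>2 \<Lambda>3 \<phi> by fact
  interpret \<phi>\<psi>: kgraph_morphism k \<Lambda>1 \<Lambda>3 "\<phi> \<circ> \<psi>" using assms by (rule kgraph_morphism_comp)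
  show ?thesis
  proof (rule \<phi>\<psi>.homology_map_eqI[OF compose_extensional])
    fix c assume c: "c \<in> cycles k r \<Lambda>1"
    then have "pushforward \<psi> c \<in> cycles k r \<Lambda>2"
      using \<psi>.pushforward_cycles by auto
    then show "compose (carrier (homology k r \<Lambda>1)) (homology_map k r \<Lambda>2 \<Lambda>3 \<phi>)
        (homology_map k r \<Lambda>1 \<Lambda>2 \<psi>) (homology_class k r \<Lambda>1 c)
        = homology_class k r \<Lambda>3 (pushforward (\<phi> \<circ> \<psi>) c)"
      using c by (simp add: compose_eq carrier_homology \<psi>.homology_map_class \<phi>.homology_map_class
          pushforward_comp)
  qed
qed

lemma category_kgraph_cat: "category (kgraph_cat k)"
proof
  fix \<Lambda> :: "'a kgraph_data" assume "\<Lambda> \<in> objects (kgraph_cat k)"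
  then have "kgraph_morphism k \<Lambda> \<Lambda> id"
    by (simp add: kgraph_cat_def kgraph_morphism_id)
  then have "kgraph_morphism k \<Lambda> \<Lambda> (restrict id (arrows \<Lambda>))"
    by (rule kgraph_morphism_cong) simp
  then show "ident (kgraph_cat k) \<Lambda> \<in> homset (kgraph_cat k) \<Lambda> \<Lambda>"
    by (simp add: kgraph_cat_def)
qed (auto simp: kgraph_cat_def kgraph_morphism_compose compose_extensional
    intro!: extensionalityI[OF compose_extensional]
    dest: kgraph_morphism.map_arrows simp: compose_eq)

lemma category_abelian_group_cat: "category abelian_group_cat"
proof
  fix G :: "'a monoid" assume "G \<in> objects abelian_group_cat"
  then interpret G: comm_group G by (simp add: abelian_group_cat_def)
  show "ident abelian_group_cat G \<in> homset abelian_group_cat G G"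
    by (auto simp: abelian_group_cat_def hom_def)
next
  fix G H K :: "'a monoid" and f g
  assume "G \<in> objects abelian_group_cat"
    and f: "f \<in> homset abelian_group_cat G H" "g \<in> homset abelian_group_cat H K"
  then interpret G: comm_group G by (simp add: abelian_group_cat_def)
  show "cmp abelian_group_cat G H K g f \<in> homset abelian_group_cat G K"
    using f by (auto simp: abelian_group_cat_def compose_extensional hom_def compose_eq Pi_iff)
qed (auto simp: abelian_group_cat_def hom_def Pi_iff compose_eq
    intro!: extensionalityI[OF compose_extensional])

lemma homology_functor:
  "covariant_functor (kgraph_cat k) abelian_group_cat (homology k r) (homology_map k r)"
proof (intro covariant_functor.intro covariant_functor_axioms.intro
    category_kgraph_cat category_abelian_group_cat)
  fix \<Lambda> :: "'a kgraph_data" assume "\<Lambda> \<in> objects (kgraph_cat k)"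
  then have \<Lambda>: "kgraph k \<Lambda>" by (simp add: kgraph_cat_def)
  then show "homology k r \<Lambda> \<in> objects abelian_group_cat"
    by (simp add: abelian_group_cat_def kgraph.comm_group_homology)
  have "homology_map k r \<Lambda> \<Lambda> (restrict id (arrows \<Lambda>)) = homology_map k r \<Lambda> \<Lambda> id"
    using kgraph_morphism_id[OF \<Lambda>] by (rule homology_map_cong) simp
  then show "homology_map k r \<Lambda> \<Lambda> (ident (kgraph_cat k) \<Lambda>) = ident abelian_group_cat (homology k r \<Lambda>)"
    using homology_map_id[OF \<Lambda>] by (simp add: kgraph_cat_def abelian_group_cat_def)
next
  fix \<Lambda>1 \<Lambda>2 :: "'a kgraph_data" and \<psi> assume "\<psi> \<in> homset (kgraph_cat k) \<Lambda>1 \<Lambda>2"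
  then interpret kgraph_morphism k \<Lambda>1 \<Lambda>2 \<psi> by (simp add: kgraph_cat_def)
  show "homology_map k r \<Lambda>1 \<Lambda>2 \<psi> \<in> homset abelian_group_cat (homology k r \<Lambda>1) (homology k r \<Lambda>2)"
    by (simp add: abelian_group_cat_def homology_map_hom homology_map_extensional)
next
  fix \<Lambda>1 \<Lambda>2 \<Lambda>3 :: "'a kgraph_data" and \<psi> \<phi>
  assume "\<psi> \<in> homset (kgraph_cat k) \<Lambda>1 \<Lambda>2" "\<phi> \<in> homset (kgraph_cat k) \<Lambda>2 \<Lambda>3"
  then have m: "kgraph_morphism k \<Lambda>1 \<Lambda>2 \<psi>" "kgraph_morphism k \<Lambda>2 \<Lambda>3 \<phi>"
    by (auto simp: kgraph_cat_def)
  have "homology_map k r \<Lambda>1 \<Lambda>3 (compose (arrows \<Lambda>1) \<phi> \<psi>) = homology_map k r \<Lambda>1 \<Lambda>3 (\<phi> \<circ> \<psi>)"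
    using kgraph_morphism_comp[OF m] by (rule homology_map_cong) (simp add: compose_eq)
  then show "homology_map k r \<Lambda>1 \<Lambda>3 (cmp (kgraph_cat k) \<Lambda>1 \<Lambda>2 \<Lambda>3 \<phi> \<psi>)
      = cmp abelian_group_cat (homology k r \<Lambda>1) (homology k r \<Lambda>2) (homology k r \<Lambda>3)
          (homology_map k r \<Lambda>2 \<Lambda>3 \<phi>) (homology_map k r \<Lambda>1 \<Lambda>2 \<psi>)"
    using homology_map_comp[OF m] by (simp add: kgraph_cat_def abelian_group_cat_def)
qed

theorem lemma3p5:
  fixes k r :: nat
  shows
    "(\<forall>(\<Lambda>1 :: 'a kgraph_data) (\<Lambda>2 :: 'b kgraph_data) \<psi>. kgraph_morphism k \<Lambda>1 \<Lambda>2 \<psi> \<longrightarrow>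
        homology_map k r \<Lambda>1 \<Lambda>2 \<psi> \<in> hom (homology k r \<Lambda>1) (homology k r \<Lambda>2) \<and>
        (\<forall>c \<in> cycles k r \<Lambda>1.
           pushforward \<psi> c \<in> cycles k r \<Lambda>2 \<and>
           homology_map k r \<Lambda>1 \<Lambda>2 \<psi> (homology_class k r \<Lambda>1 c)
             = homology_class k r \<Lambda>2 (pushforward \<psi> c)) \<and>
        (\<forall>f \<in> hom (homology k r \<Lambda>1) (homology k r \<Lambda>2).
           (\<forall>c \<in> cycles k r \<Lambda>1.
              f (homology_class k r \<Lambda>1 c) = homology_class k r \<Lambda>2 (pushforward \<psi> c)) \<longrightarrow>
           (\<forall>x \<in> carrier (homology k r \<Lambda>1). f x = homology_map k r \<Lambda>1 \<Lambda>2 \<psi> x)))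
     \<and> covariant_functor (kgraph_cat k :: ('a kgraph_data, 'a \<Rightarrow> 'a) cat) abelian_group_cat
         (homology k r) (homology_map k r)
     \<and> (\<forall>(\<Lambda>1 :: 'a kgraph_data) (\<Lambda>2 :: 'b kgraph_data) (\<Lambda>3 :: 'c kgraph_data) \<psi> \<phi>.
          kgraph_morphism k \<Lambda>1 \<Lambda>2 \<psi> \<and> kgraph_morphism k \<Lambda>2 \<Lambda>3 \<phi> \<longrightarrow>
          kgraph_morphism k \<Lambda>1 \<Lambda>3 (\<phi> \<circ> \<psi>) \<and>
          homology_map k r \<Lambda>1 \<Lambda>3 (\<phi> \<circ> \<psi>)
            = compose (carrier (homology k r \<Lambda>1)) (homology_map k r \<Lambda>2 \<Lambda>3 \<phi>) (homology_map k r \<Lambda>1 \<Lambda>2 \<psi>))"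
proof (intro conjI allI impI ballI)
  fix \<Lambda>1 :: "'a kgraph_data" and \<Lambda>2 :: "'b kgraph_data" and \<psi>
  assume "kgraph_morphism k \<Lambda>1 \<Lambda>2 \<psi>"
  then interpret kgraph_morphism k \<Lambda>1 \<Lambda>2 \<psi> .
  show "homology_map k r \<Lambda>1 \<Lambda>2 \<psi> \<in> hom (homology k r \<Lambda>1) (homology k r \<Lambda>2)"
    by (rule homology_map_hom)
  show "pushforward \<psi> c \<in> cycles k r \<Lambda>2" if "c \<in> cycles k r \<Lambda>1" for c
    using pushforward_cycles that by blast
  show "homology_map k r \<Lambda>1 \<Lambda>2 \<psi> (homology_class k r \<Lambda>1 c) = homology_class k r \<Lambda>2 (pushforward \<psi> c)"
    if "c \<in> cycles k r \<Lambda>1" for c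
    using that by (rule homology_map_class)
  show "f X = homology_map k r \<Lambda>1 \<Lambda>2 \<psi> X"
    if "\<forall>c \<in> cycles k r \<Lambda>1. f (homology_class k r \<Lambda>1 c) = homology_class k r \<Lambda>2 (pushforward \<psi> c)"
      and "X \<in> carrier (homology k r \<Lambda>1)" for f X
    using homology_map_unique[OF _ homology_map_class that(2)] that(1) by blast
next
  show "covariant_functor (kgraph_cat k :: ('a kgraph_data, 'a \<Rightarrow> 'a) cat) abelian_group_cat
      (homology k r) (homology_map k r)"
    by (rule homology_functor)
next
  fix \<Lambda>1 :: "'a kgraph_data" and \<Lambda>2 :: "'b kgraph_data" and \<Lambda>3 :: "'c kgraph_data" and \<psi> \<phi>
  assume "kgraph_morphism k \<Lambda>1 \<Lambda>2 \<psi> \<and> kgraph_morphism k \<Lambda>2 \<Lambda>3 \<phi>"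
  then have m: "kgraph_morphism k \<Lambda>1 \<Lambda>2 \<psi>" "kgraph_morphism k \<Lambda>2 \<Lambda>3 \<phi>" by auto
  show "kgraph_morphism k \<Lambda>1 \<Lambda>3 (\<phi> \<circ> \<psi>)"
    using m by (rule kgraph_morphism_comp)
  show "homology_map k r \<Lambda>1 \<Lambda>3 (\<phi> \<circ> \<psi>)
      = compose (carrier (homology k r \<Lambda>1)) (homology_map k r \<Lambda>2 \<Lambda>3 \<phi>) (homology_map k r \<Lambda>1 \<Lambda>2 \<psi>)"
    using m by (rule homology_map_comp)
qed

end
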